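(* Let $\mathscr M=(\mathscr S,\mathbf P)$ be a stationary and ergodic Markov chain on a finite state space $\mathscr S=\{\mathsf W_1,\dots,\mathsf W_N\}$ with transition matrix $\mathbf P=(p_{ij})_{1\le i,j\le N}$ and invariant probability distribution $\bm\pi=(\pi_1,\dots,\pi_N)$. Let $\mathscr W\subsetneqq\mathscr S$ be a non-empty proper subset such that $\pi_ip_{ij}=\pi_jp_{ji}$ for all $\mathsf W_i,\mathsf W_j\in\mathscr S\smallsetminus\mathscr W$. Then there is a probability measure $\mathscr P_{\mathscr W}$ supported on $\lambda\in(-1,1)$ such that for all $s\in\mathbb Z_{\ge0}$, $$\frac{1-R_{\mathscr W}(s+2)}{1-R_{\mathscr W}(2)}=\frac{\sum_{\mathsf W_i\in\mathscr W}\mathbb P^{\mathsf W_i}(\tau_{\mathscr W}>s+1)\,\pi_i}{\sum_{\mathsf W_i\in\mathscr W}\mathbb P^{\mathsf W_i}(\tau_{\mathscr W}>1)\,\pi_i}=\int\rho_\lambda(s)\,\mathrm d\mathscr P_{\mathscr W}(\lambda).$$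
   Context: The chain is a discrete-time, time-homogeneous Markov process $(X(t))_{t\in\mathbb Z_{\ge0}}$ on the finite set $\mathscr S$, with $p_{ij}=\mathbb P(X(n+1)=\mathsf W_j\mid X(n)=\mathsf W_i)$ for all $n\ge 0$. $\mathbb P^{\mathsf W_i}$ denotes the law of the chain started at $X(0)=\mathsf W_i$. Ergodic means that from any state there is a strictly positive probability of reaching any other state after finitely many steps; such a chain has a unique equilibrium state (invariant distribution) $\bm\pi$, i.e. $\pi_i\ge0$, $\sum_i\pi_i=1$, $\sum_i\pi_ip_{ij}=\pi_j$ for all $j$. For a subset $\mathscr W\subseteq\mathscr S$ and a trajectory $\omega=(X(t))_{t\in\mathbb Z_{\ge0}}$, define $$\tau_{\mathscr W}(\omega):=\inf\{n\in\mathbb Z_{>0}: X(n)\in\mathscr W\}\in\mathbb Z_{>0}\cup\{+\infty\}.$$ For $t\in\mathbb Z_{>0}$, the cumulative distribution function (with strict inequality) of the return time to $\mathscr W$ is $$R_{\mathscr W}(t):=\sum_{\mathsf W_i\in\mathscr W}\mathbb P^{\mathsf W_i}(\tau_{\mathscr W}<t)\,\frac{\pi_i}{\sum_{\mathsf W_j\in\mathscr W}\pi_j}.$$ For $\lambda\in(-1,1)$, $\rho_\lambda:\mathbb Z_{\ge0}\to\mathbb R$ is the semicharacter $\rho_\lambda(s)=\lambda^s$ with the convention $\rho_\lambda(0)=1$; in particular $\rho_0(s)=\mathbf 1_{\{0\}}(s)$. *)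

theory Defs
  imports "HOL-Probability.Probability" "HOL-Library.Extended_Nat"
begin

text \<open>
  The state space is the finite type \<^typ>\<open>'s\<close>; the state \<open>W\<^sub>i\<close> is identified with its index.
\<close>

definition stochastic_matrix :: "('s::finite \<Rightarrow> 's \<Rightarrow> real) \<Rightarrow> bool" where
  "stochastic_matrix p \<longleftrightarrow> (\<forall>i j. 0 \<le> p i j) \<and> (\<forall>i. (\<Sum>j\<in>UNIV. p i j) = 1)"

definition invariant_distribution :: "('s::finite \<Rightarrow> 's \<Rightarrow> real) \<Rightarrow> ('s \<Rightarrow> real) \<Rightarrow> bool" where
  "invariant_distribution p \<pi> \<longleftrightarrow>
     (\<forall>i. 0 \<le> \<pi> i) \<and> (\<Sum>i\<in>UNIV. \<pi> i) = 1 \<and> (\<forall>j. (\<Sum>i\<in>UNIV. \<pi> i * p i j) = \<pi> j)"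

text \<open>
  Conditional law of \<open>X(n)\<close> given the coordinates of \<open>\<omega>\<close> before time \<open>n\<close>, for the time-homogeneous
  chain with transition matrix \<open>p\<close> started at \<open>X(0) = i\<close>.
\<close>

definition step_law :: "('s::finite \<Rightarrow> 's \<Rightarrow> real) \<Rightarrow> 's \<Rightarrow> nat \<Rightarrow> (nat \<Rightarrow> 's) \<Rightarrow> 's measure" where
  "step_law p i n \<omega> =
     (case n of 0 \<Rightarrow> return (count_space UNIV) i
      | Suc m \<Rightarrow> point_measure UNIV (\<lambda>j. ennreal (p (\<omega> m) j)))"

text \<open>
  The law of the chain started at \<open>i\<close>, on the space of trajectories \<^typ>\<open>nat \<Rightarrow> 's\<close> with the
  product sigma-algebra: the projective limit given by the Ionescu-Tulcea theorem for the kernels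
  above. The lemmas \<open>path_law_start\<close>, \<open>path_law_cylinder\<close> and \<open>path_law_Markov\<close> below characterise it.
\<close>

definition path_law :: "('s::finite \<Rightarrow> 's \<Rightarrow> real) \<Rightarrow> 's \<Rightarrow> (nat \<Rightarrow> 's) measure" where
  "path_law p i =
     projective_family.lim UNIV (Ionescu_Tulcea.CI (step_law p i) (\<lambda>_. count_space UNIV))
       (\<lambda>_. count_space UNIV)"

definition ergodic_chain :: "('s::finite \<Rightarrow> 's \<Rightarrow> real) \<Rightarrow> bool" where
  "ergodic_chain p \<longleftrightarrow> (\<forall>i j. i \<noteq> j \<longrightarrow> 0 < \<P>(\<omega> in path_law p i. \<exists>n. \<omega> n = j))"

text \<open>Time \<open>0\<close> is excluded, and the infimum of the empty set is \<open>\<infinity>\<close>.\<close>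

definition return_time :: "'s set \<Rightarrow> (nat \<Rightarrow> 's) \<Rightarrow> enat" where
  "return_time W \<omega> = (INF n\<in>{n. 0 < n \<and> \<omega> n \<in> W}. enat n)"

definition return_cdf :: "('s::finite \<Rightarrow> 's \<Rightarrow> real) \<Rightarrow> ('s \<Rightarrow> real) \<Rightarrow> 's set \<Rightarrow> nat \<Rightarrow> real" where
  "return_cdf p \<pi> W t =
     (\<Sum>i\<in>W. \<P>(\<omega> in path_law p i. return_time W \<omega> < enat t) * (\<pi> i / (\<Sum>j\<in>W. \<pi> j)))"

text \<open>Used for \<open>\<bar>l\<bar> < 1\<close>; the convention at \<open>s = 0\<close> is the library value \<open>0 ^ 0 = 1\<close>.\<close>

definition semichar :: "real \<Rightarrow> nat \<Rightarrow> real" where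
  "semichar l s = l ^ s"

lemma semichar_0 [simp]: "semichar l 0 = 1" and semichar_zero: "semichar 0 s = indicator {0} s"
  by (auto simp: semichar_def indicator_def power_0_left)

context
  fixes p :: "'s::finite \<Rightarrow> 's \<Rightarrow> real" and i :: 's
  assumes p: "stochastic_matrix p"
begin

lemma prob_space_row: "prob_space (point_measure UNIV (\<lambda>j. ennreal (p k j)))"
proof
  have "(\<Sum>j\<in>UNIV. ennreal (p k j)) = ennreal (\<Sum>j\<in>UNIV. p k j)"
    using p by (intro sum_ennreal) (auto simp: stochastic_matrix_def)
  then show "emeasure (point_measure UNIV (\<lambda>j. ennreal (p k j)))
      (space (point_measure UNIV (\<lambda>j. ennreal (p k j)))) = 1"
    using p by (simp add: space_point_measure emeasure_point_measure_finite stochastic_matrix_def)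
qed

lemma prob_space_step_law: "prob_space (step_law p i n \<omega>)"
  by (cases n) (auto simp: step_law_def prob_space_row intro!: prob_space_return)

lemma measurable_step_law:
  "step_law p i n \<in> measurable (PiM {0..<n} (\<lambda>_. count_space UNIV)) (subprob_algebra (count_space UNIV))"
proof (cases n)
  case 0
  have "return (count_space UNIV) i \<in> space (subprob_algebra (count_space UNIV))"
    by (auto simp: space_subprob_algebra intro!: prob_space_return prob_space_imp_subprob_space)
  then show ?thesis
    using 0 by (simp add: step_law_def[abs_def])
next
  case (Suc m)
  have row: "(\<lambda>k. point_measure UNIV (\<lambda>j. ennreal (p k j)))
      \<in> measurable (count_space UNIV) (subprob_algebra (count_space UNIV))"
    by (auto simp: space_subprob_algebra sets_point_measure prob_space_row
        intro!: prob_space_imp_subprob_space)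
  have "(\<lambda>\<omega>. \<omega> m) \<in> measurable (PiM {0..<n} (\<lambda>_. count_space UNIV)) (count_space (UNIV :: 's set))"
    using Suc by (intro measurable_component_singleton) simp
  from measurable_compose[OF this row] show ?thesis
    using Suc by (simp add: step_law_def[abs_def])
qed

interpretation IT: Ionescu_Tulcea "step_law p i" "\<lambda>_. count_space UNIV"
  using measurable_step_law prob_space_step_law by (rule Ionescu_Tulcea.intro)

lemma sets_path_law: "sets (path_law p i) = sets (PiM UNIV (\<lambda>_. count_space UNIV))"
  and space_path_law: "space (path_law p i) = UNIV"
  by (simp_all add: path_law_def space_PiM)

lemma prob_space_path_law: "prob_space (path_law p i)"
proof
  interpret C: prob_space "IT.CI {}"
    by (rule IT.PF.prob_space_P) simp_all
  have "space (IT.CI {}) = {\<lambda>_. undefined}"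
    by (simp add: IT.CI_def space_PiM)
  then have "emeasure (IT.CI {}) {\<lambda>_. undefined} = 1"
    using C.emeasure_space_1 by simp
  moreover have "emeasure (path_law p i) (IT.PF.emb UNIV {} {\<lambda>_. undefined})
      = emeasure (IT.CI {}) {\<lambda>_. undefined}"
    unfolding path_law_def by (rule IT.lim) (simp_all add: sets_PiM_empty)
  moreover have "IT.PF.emb UNIV {} {\<lambda>_. undefined} = UNIV"
    by (auto simp: prod_emb_def space_PiM)
  ultimately show "emeasure (path_law p i) (space (path_law p i)) = 1"
    by (simp add: space_path_law)
qed

lemma sets_cylinder: "{\<omega>. \<forall>k<n. \<omega> k = x k} \<in> sets (path_law p i)"
proof -
  have "{\<omega>. \<forall>k<n. \<omega> k = x k} = (\<Inter>k<n. {\<omega>\<in>space (PiM UNIV (\<lambda>_. count_space UNIV)). \<omega> k \<in> {x k}})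
      \<inter> space (PiM UNIV (\<lambda>_. count_space UNIV))"
    by (auto simp: space_PiM)
  also have "\<dots> \<in> sets (PiM UNIV (\<lambda>_. count_space UNIV))"
    by (cases n) (auto intro!: sets.Int sets.finite_INT)
  finally show ?thesis by (simp add: sets_path_law)
qed

lemma emeasure_cylinder_C:
  "emeasure (IT.C 0 n (\<lambda>_. undefined))
     {\<omega>\<in>space (PiM {0..<n} (\<lambda>_. count_space UNIV)). \<forall>k<n. \<omega> k = x k}
   = (\<Prod>k<n. emeasure (step_law p i k x) {x k})"
proof (induction n)
  case 0
  show ?case by (simp add: space_PiM_empty sets_PiM_empty)
next
  case (Suc n)
  let ?S = "\<lambda>n. space (PiM {0..<n} (\<lambda>_. count_space (UNIV :: 's set)))"
  let ?E = "\<lambda>n. {\<omega>\<in>?S n. \<forall>k<n. \<omega> k = x k}"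
  have E: "?E m \<in> sets (PiM {0..<m} (\<lambda>_. count_space UNIV))" for m
  proof -
    have "?E m = ?S m \<inter> PiE {0..<m} (\<lambda>k. {x k})"
      by (auto simp: space_PiM PiE_iff extensional_def)
    then show ?thesis by (auto intro!: sets.Int sets_PiM_I_finite)
  qed
  have step: "emeasure (IT.eP n \<omega>) (?E (Suc n)) =
      emeasure (step_law p i n x) {x n} * indicator (?E n) \<omega>" if "\<omega> \<in> ?S n" for \<omega>
  proof -
    have "emeasure (IT.eP n \<omega>) (?E (Suc n)) =
        emeasure (step_law p i n \<omega>) ((\<lambda>y. fun_upd \<omega> n y) -` ?E (Suc n) \<inter> UNIV)"
      using IT.emeasure_eP[OF that E[of "Suc n"]] by simp
    also have "(\<lambda>y. fun_upd \<omega> n y) -` ?E (Suc n) \<inter> UNIV = (if \<omega> \<in> ?E n then {x n} else {})"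
      using that by (auto simp: space_PiM PiE_iff extensional_def less_Suc_eq split: if_splits)
    also have "emeasure (step_law p i n \<omega>) \<dots> =
        emeasure (step_law p i n x) {x n} * indicator (?E n) \<omega>"
      by (cases n) (auto simp: step_law_def)
    finally show ?thesis .
  qed
  have sp: "space (IT.C 0 n (\<lambda>_. undefined)) = ?S n"
    by (subst IT.space_C) (auto simp: space_PiM)
  have se: "sets (IT.C 0 n (\<lambda>_. undefined)) = sets (PiM {0..<n} (\<lambda>_. count_space UNIV))"
    by (subst IT.sets_C) (auto simp: space_PiM)
  have ne: "?S n \<noteq> {}"
    by (auto simp: space_PiM PiE_eq_empty_iff)
  have m: "IT.eP n \<in> measurable (IT.C 0 n (\<lambda>_. undefined))
      (subprob_algebra (PiM {0..<Suc n} (\<lambda>_. count_space UNIV)))"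
    using IT.measurable_eP[of n] by (simp add: measurable_cong_sets[OF se refl])
  have "emeasure (IT.C 0 (Suc n) (\<lambda>_. undefined)) (?E (Suc n)) =
      (\<integral>\<^sup>+\<omega>. emeasure (IT.eP n \<omega>) (?E (Suc n)) \<partial>IT.C 0 n (\<lambda>_. undefined))"
    using emeasure_bind[OF _ m E[of "Suc n"]] ne sp by simp
  also have "\<dots> = (\<integral>\<^sup>+\<omega>. emeasure (step_law p i n x) {x n} * indicator (?E n) \<omega>
      \<partial>IT.C 0 n (\<lambda>_. undefined))"
    by (intro nn_integral_cong step) (simp add: sp)
  also have "\<dots> = emeasure (step_law p i n x) {x n} * emeasure (IT.C 0 n (\<lambda>_. undefined)) (?E n)"
    using E[of n] by (intro nn_integral_cmult_indicator) (simp add: se)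
  finally show ?case
    by (simp add: Suc.IH mult.commute)
qed

lemma emeasure_cylinder:
  "emeasure (path_law p i) {\<omega>. \<forall>k<n. \<omega> k = x k} = (\<Prod>k<n. emeasure (step_law p i k x) {x k})"
proof -
  let ?E = "{\<omega>\<in>space (PiM {0..<n} (\<lambda>_. count_space UNIV)). \<forall>k<n. \<omega> k = x k}"
  have "?E = space (PiM {0..<n} (\<lambda>_. count_space UNIV)) \<inter> PiE {0..<n} (\<lambda>k. {x k})"
    by (auto simp: space_PiM PiE_iff extensional_def)
  then have E: "?E \<in> sets (PiM {0..<n} (\<lambda>_. count_space UNIV))"
    by (auto intro!: sets.Int sets_PiM_I_finite)
  have "{\<omega>. \<forall>k<n. \<omega> k = x k} = IT.PF.emb UNIV {0..<n} ?E"
    by (auto simp: prod_emb_def space_PiM)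
  then have "emeasure (path_law p i) {\<omega>. \<forall>k<n. \<omega> k = x k} = emeasure (IT.CI {0..<n}) ?E"
    using IT.lim[OF _ E] by (simp add: path_law_def)
  also have "\<dots> = emeasure (IT.C 0 n (\<lambda>_. undefined)) (IT.PF.emb {0..<n} {0..<n} ?E)"
    by (rule IT.emeasure_CI[OF _ E]) simp
  also have "IT.PF.emb {0..<n} {0..<n} ?E = ?E"
    by (rule prod_emb_id) (auto simp: space_PiM)
  finally show ?thesis
    using emeasure_cylinder_C by simp
qed

lemma path_law_cylinder:
  "\<P>(\<omega> in path_law p i. \<forall>k\<le>n. \<omega> k = x k) = indicator {i} (x 0) * (\<Prod>k<n. p (x k) (x (Suc k)))"
proof -
  have "emeasure (path_law p i) {\<omega>. \<forall>k\<le>n. \<omega> k = x k} =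
      (\<Prod>k<Suc n. emeasure (step_law p i k x) {x k})"
    using emeasure_cylinder[of "Suc n" x] by (simp add: less_Suc_eq_le)
  also have "\<dots> = indicator {x 0} i * (\<Prod>k<n. ennreal (p (x k) (x (Suc k))))"
    by (subst prod.lessThan_Suc_shift)
       (simp add: step_law_def emeasure_point_measure_finite)
  also have "\<dots> = ennreal (indicator {i} (x 0) * (\<Prod>k<n. p (x k) (x (Suc k))))"
    using p by (auto simp: prod_ennreal stochastic_matrix_def indicator_def)
  finally show ?thesis
    using p by (simp add: measure_def space_path_law prod_nonneg stochastic_matrix_def)
qed

lemma path_law_start: "AE \<omega> in path_law p i. \<omega> 0 = i"
proof -
  interpret prob_space "path_law p i" by (rule prob_space_path_law)
  have "\<P>(\<omega> in path_law p i. \<omega> 0 = i) = 1"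
    using path_law_cylinder[of 0 "\<lambda>_. i"] by simp
  then show ?thesis
    using sets_cylinder[of "Suc 0" "\<lambda>_. i"] by (subst (asm) prob_Collect_eq_1) (auto simp: space_path_law)
qed

lemma path_law_Markov:
  assumes "0 < \<P>(\<omega> in path_law p i. \<forall>k\<le>n. \<omega> k = x k)"
  shows "\<P>(\<omega> in path_law p i. \<omega> (Suc n) = j \<bar> \<forall>k\<le>n. \<omega> k = x k) = p (x n) j"
proof -
  have "{\<omega>\<in>space (path_law p i). \<omega> (Suc n) = j \<and> (\<forall>k\<le>n. \<omega> k = x k)} =
      {\<omega>\<in>space (path_law p i). \<forall>k\<le>Suc n. \<omega> k = (x(Suc n := j)) k}"
    by (auto simp: le_Suc_eq)
  then have "\<P>(\<omega> in path_law p i. \<omega> (Suc n) = j \<and> (\<forall>k\<le>n. \<omega> k = x k)) =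
      \<P>(\<omega> in path_law p i. \<forall>k\<le>n. \<omega> k = x k) * p (x n) j"
    by (simp only: path_law_cylinder) (simp add: fun_upd_def cong: prod.cong_simp)
  then show ?thesis
    using assms by (simp add: cond_prob_def)
qed

end

end

theory Submission
  imports Defs
begin

text \<open>
  Let \<open>m s = \<langle>1, Q\<^sup>s 1\<rangle>\<close> in \<open>L\<^sup>2(\<pi>)\<close>, where \<open>Q\<close> is the transition matrix restricted to the complement of \<open>W\<close>.
  By invariance of \<open>\<pi>\<close>, the flow from \<open>W\<close> into a state \<open>j\<close> outside \<open>W\<close> is
  \<open>\<pi> j - (\<Sum>k\<in>-W. \<pi> k * p k j)\<close>, so the weighted tail of the return time telescopes to \<open>m s - m (s + 1)\<close>.
  Detailed balance makes \<open>Q\<close> self-adjoint, hence \<open>m s = (\<Sum>b. w b * l b ^ s)\<close> with \<open>w b \<ge> 0\<close>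
  and eigenvalues \<open>l b\<close>, and the tail is the mixture of the \<open>l b ^ s\<close> with weights
  \<open>w b * (1 - l b)\<close>. A maximum principle bounds the eigenvalues strictly by \<open>1\<close>: the set where an
  eigenvector of an eigenvalue of modulus at least \<open>1\<close> has maximal modulus is closed under
  transitions and avoids \<open>W\<close>, contradicting ergodicity.
\<close>

section \<open>Self-adjoint maps on Euclidean spaces and their moment measures\<close>

lemma selfadjoint_eigenvector:
  fixes T :: "'a::euclidean_space \<Rightarrow> 'a"
  assumes T: "linear T" and S: "subspace S" "S \<noteq> {0}" and inv: "T ` S \<subseteq> S"
    and sym: "\<And>x y. x \<in> S \<Longrightarrow> y \<in> S \<Longrightarrow> T x \<bullet> y = x \<bullet> T y"
  obtains x l where "x \<in> S" "norm x = 1" "T x = l *\<^sub>R x"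
proof -
  \<comment> \<open>A maximiser of the Rayleigh quotient on \<open>S\<close> is an eigenvector.\<close>
  let ?K = "S \<inter> sphere 0 1"
  have cpt: "compact ?K"
    using closed_subspace[OF S(1)] by (metis compact_sphere closed_Int_compact)
  obtain a where a: "a \<in> S" "a \<noteq> 0"
    using S subspace_0 by blast
  then have "a /\<^sub>R norm a \<in> ?K"
    using S by (auto intro: subspace_scale)
  then have ne: "?K \<noteq> {}" by blast
  have "continuous_on ?K (\<lambda>x. T x \<bullet> x)"
    by (intro continuous_intros linear_continuous_on linear_conv_bounded_linear[THEN iffD1] T)
  from continuous_attains_sup[OF cpt ne this] obtain x
    where x: "x \<in> S" "norm x = 1" and sup: "\<And>y. y \<in> ?K \<Longrightarrow> T y \<bullet> y \<le> T x \<bullet> x"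
    by auto
  define l where "l = T x \<bullet> x"
  have pos: "T y \<bullet> y \<le> l * (y \<bullet> y)" if "y \<in> S" for y
  proof (cases "y = 0")
    case False
    then have "T (y /\<^sub>R norm y) \<bullet> (y /\<^sub>R norm y) \<le> l"
      using that S unfolding l_def by (intro sup) (auto intro: subspace_scale)
    then show ?thesis
      using False by (simp add: linear_scale[OF T] field_simps power2_norm_eq_inner[symmetric] power2_eq_square)
  qed (use T in \<open>simp add: linear_0\<close>)
  \<comment> \<open>The form \<open>l * (y \<bullet> y) - T y \<bullet> y\<close> is nonnegative on
    \<open>S\<close> and zero at \<open>x\<close>; its first variation at \<open>x\<close> in the
    direction of the residual \<open>z\<close> is \<open>2 * (z \<bullet> z)\<close>, which must
    therefore vanish.\<close>
  define z where "z = l *\<^sub>R x - T x"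
  have z: "z \<in> S"
    unfolding z_def using S x inv by (intro subspace_diff subspace_scale) auto
  have "z \<bullet> z = 0"
  proof (rule ccontr)
    assume nz: "z \<bullet> z \<noteq> 0"
    define q where "q = l * (z \<bullet> z) - T z \<bullet> z"
    have q: "0 \<le> q" using pos[OF z] by (simp add: q_def)
    have xz: "x \<bullet> T z = T x \<bullet> z" using sym x z by simp
    have *: "0 \<le> 2 * t * (z \<bullet> z) + t\<^sup>2 * q" for t
    proof -
      have "x + t *\<^sub>R z \<in> S" using S x z by (intro subspace_add subspace_scale)
      from pos[OF this] have "0 \<le> l * ((x + t *\<^sub>R z) \<bullet> (x + t *\<^sub>R z)) - T (x + t *\<^sub>R z) \<bullet> (x + t *\<^sub>R z)"
        by simp
      also have "\<dots> = (l * (x \<bullet> x) - T x \<bullet> x) + 2 * t * (l * (x \<bullet> z) - T x \<bullet> z) + t\<^sup>2 * q"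
        using xz by (simp add: linear_add[OF T] linear_scale[OF T] inner_add_left inner_add_right q_def
            algebra_simps power2_eq_square inner_commute)
      also have "l * (x \<bullet> x) - T x \<bullet> x = 0"
        using x by (simp add: l_def dot_square_norm)
      also have "l * (x \<bullet> z) - T x \<bullet> z = z \<bullet> z"
        by (simp add: z_def inner_diff_left inner_diff_right algebra_simps)
      finally show ?thesis by simp
    qed
    have zz: "0 < z \<bullet> z" using nz by (simp add: inner_gt_zero_iff)
    \<comment> \<open>A small negative \<open>t\<close> violates the quadratic bound: this choice
      reduces it to \<open>t * (z \<bullet> z) - t\<^sup>2\<close>. The \<open>+ 1\<close> keeps the
      denominator positive if \<open>q = 0\<close>.\<close>
    define t where "t = - (z \<bullet> z) / (q + 1)"
    have t: "t < 0" using q zz by (simp add: t_def)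
    have "t * (q + 1) = - (z \<bullet> z)" using q by (simp add: t_def)
    then have "2 * t * (z \<bullet> z) + t\<^sup>2 * q = t * (z \<bullet> z) - t\<^sup>2"
      by algebra
    moreover have "t * (z \<bullet> z) < 0" using t zz by (rule mult_neg_pos)
    ultimately show False using *[of t] by (smt (verit) zero_le_power2)
  qed
  then have "T x = l *\<^sub>R x" by (simp add: z_def)
  with x show thesis by (rule that)
qed

text \<open>Induction on the dimension: a unit eigenvector \<open>x\<close> is split off, and its
  orthogonal complement in \<open>S\<close> is invariant because
  \<open>x \<bullet> T y = T x \<bullet> y\<close> is a multiple of
  \<open>x \<bullet> y\<close>.\<close>

lemma selfadjoint_eigenbasis:
  fixes T :: "'a::euclidean_space \<Rightarrow> 'a"
  assumes "linear T" "subspace S" "T ` S \<subseteq> S"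
    and "\<And>x y. x \<in> S \<Longrightarrow> y \<in> S \<Longrightarrow> T x \<bullet> y = x \<bullet> T y"
  shows "\<exists>B l. finite B \<and> 0 \<notin> B \<and> pairwise orthogonal B \<and> span B = S \<and> (\<forall>b\<in>B. T b = l b *\<^sub>R b)"
  using assms
proof (induction "dim S" arbitrary: S rule: less_induct)
  case less
  note T = less.prems(1) and S = less.prems(2) and inv = less.prems(3) and sym = less.prems(4)
  show ?case
  proof (cases "S = {0}")
    case True
    then show ?thesis by (intro exI[of _ "{}"]) simp
  next
    case False
    obtain x c where x: "x \<in> S" "norm x = 1" and ev: "T x = c *\<^sub>R x"
      using selfadjoint_eigenvector[OF T S False inv sym] by metis
    have xx: "x \<bullet> x = 1" using x by (simp add: dot_square_norm)
    define S' where "S' = S \<inter> {y. x \<bullet> y = 0}"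
    have S': "subspace S'"
      unfolding S'_def using S subspace_hyperplane by (rule subspace_inter)
    have "x \<notin> S'" "S' \<subseteq> S" using xx by (auto simp: S'_def)
    then have "S' \<subset> S" using x by blast
    then have "dim S' < dim S"
      using S S' by (metis dim_psubset span_eq_iff)
    moreover have "T ` S' \<subseteq> S'"
    proof (intro image_subsetI)
      fix y assume y: "y \<in> S'"
      have "x \<bullet> T y = T x \<bullet> y" using sym x y by (simp add: S'_def)
      with y inv show "T y \<in> S'" by (auto simp: S'_def ev)
    qed
    moreover have "T y \<bullet> z = y \<bullet> T z" if "y \<in> S'" "z \<in> S'" for y z
      using that sym by (simp add: S'_def)
    ultimately obtain B l where B: "finite B" "0 \<notin> B" "pairwise orthogonal B" "span B = S'"
      and l: "\<forall>b\<in>B. T b = l b *\<^sub>R b"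
      using less.hyps[of S'] T S' by blast
    have BS': "b \<in> S'" if "b \<in> B" for b using B(4) that span_base by blast
    then have xB: "x \<notin> B" using xx by (auto simp: S'_def)
    have "span (insert x B) = S"
    proof
      show "span (insert x B) \<subseteq> S"
        using x BS' S by (intro span_minimal) (auto simp: S'_def)
      show "S \<subseteq> span (insert x B)"
      proof
        fix y assume y: "y \<in> S"
        have "y - (x \<bullet> y) *\<^sub>R x \<in> S'"
          using y x S xx by (auto simp: S'_def inner_diff_right intro: subspace_diff subspace_scale)
        then show "y \<in> span (insert x B)"
          using B(4) by (auto simp: span_insert)
      qed
    qed
    moreover have "pairwise orthogonal (insert x B)"
      using B(3) BS' by (auto simp: pairwise_insert S'_def orthogonal_def inner_commute)
    moreover have "\<forall>b\<in>insert x B. T b = (l(x := c)) b *\<^sub>R b"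
      using l ev xB by auto
    moreover have "0 \<notin> insert x B" using x B by auto
    ultimately show ?thesis using B(1) by blast
  qed
qed

text \<open>Discrete spectral measure of \<open>u\<close>: expand \<open>u\<close> with coefficients
  \<open>c b\<close> in an orthogonal eigenbasis; the cross terms vanish and leave
  \<open>w b = (c b)\<^sup>2 * (b \<bullet> b)\<close>.\<close>

lemma selfadjoint_moments:
  fixes T :: "'a::euclidean_space \<Rightarrow> 'a"
  assumes T: "linear T" and sym: "\<And>x y. T x \<bullet> y = x \<bullet> T y"
  obtains B :: "'a set" and l w where "finite B" "\<And>b. b \<in> B \<Longrightarrow> b \<noteq> 0 \<and> T b = l b *\<^sub>R b"
    "\<And>b. b \<in> B \<Longrightarrow> 0 \<le> w b" "\<And>s. u \<bullet> (T ^^ s) u = (\<Sum>b\<in>B. w b * l b ^ s)"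
proof -
  obtain B l where B: "finite B" "0 \<notin> B" "pairwise orthogonal B" "span B = UNIV"
    and l: "\<forall>b\<in>B. T b = l b *\<^sub>R b"
    using selfadjoint_eigenbasis[OF T subspace_UNIV] sym by auto
  have "u \<in> span B" using B by simp
  then obtain c where u: "u = (\<Sum>b\<in>B. c b *\<^sub>R b)"
    by (auto simp: span_finite[OF B(1)])
  have pow: "(T ^^ s) u = (\<Sum>b\<in>B. (c b * l b ^ s) *\<^sub>R b)" for s
  proof (induction s)
    case (Suc s)
    then show ?case
      using l by (simp add: linear_sum[OF T] linear_scale[OF T] mult_ac)
  qed (simp add: u)
  have "u \<bullet> (T ^^ s) u = (\<Sum>b\<in>B. ((c b)\<^sup>2 * (b \<bullet> b)) * l b ^ s)" for s
  proof -
    have "u \<bullet> (T ^^ s) u = (\<Sum>b\<in>B. \<Sum>d\<in>B. c b * (c d * l b ^ s) * (b \<bullet> d))"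
      unfolding pow by (subst u) (simp add: inner_sum_left inner_sum_right sum_distrib_left mult_ac inner_commute)
    also have "\<dots> = (\<Sum>b\<in>B. \<Sum>d\<in>B. if d = b then ((c b)\<^sup>2 * (b \<bullet> b)) * l b ^ s else 0)"
      using B(3) by (intro sum.cong refl) (auto simp: pairwise_def orthogonal_def power2_eq_square)
    finally show ?thesis using B(1) by simp
  qed
  then show thesis
    using B l by (intro that[of B l "\<lambda>b. (c b)\<^sup>2 * (b \<bullet> b)"]) auto
qed

text \<open>The measure is the image under \<open>l\<close> of the weights \<open>w\<close> on
  \<open>B\<close>; as \<open>l\<close> need not be injective, atoms at equal values merge.\<close>

lemma finite_mixture_measure:
  fixes l w :: "'a \<Rightarrow> real"
  assumes B: "finite B" and w: "\<And>b. b \<in> B \<Longrightarrow> 0 \<le> w b" "(\<Sum>b\<in>B. w b) = 1"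
    and l: "\<And>b. b \<in> B \<Longrightarrow> l b \<in> A" and A: "A \<in> sets borel"
  shows "\<exists>\<mu> :: real measure. prob_space \<mu> \<and> sets \<mu> = sets borel \<and> measure \<mu> A = 1 \<and>
    (\<forall>s. (\<integral>x. x ^ s \<partial>\<mu>) = (\<Sum>b\<in>B. w b * l b ^ s))"
proof -
  let ?M = "point_measure B (\<lambda>b. ennreal (w b))"
  have M: "prob_space ?M"
  proof
    show "emeasure ?M (space ?M) = 1"
      using B w by (simp add: space_point_measure emeasure_point_measure_finite sum_ennreal)
  qed
  have meas: "l \<in> ?M \<rightarrow>\<^sub>M borel"
    by (simp add: point_measure_def)
  let ?D = "distr ?M borel l"
  have "measure ?D A = measure ?M (space ?M)"
    using A l meas by (subst measure_distr) (auto simp: space_point_measure intro!: arg_cong[where f="measure ?M"])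
  moreover have "(\<integral>x. x ^ s \<partial>?D) = (\<Sum>b\<in>B. w b * l b ^ s)" for s
    using B w by (subst integral_distr[OF meas]) (auto simp: lebesgue_integral_point_measure_finite)
  ultimately show ?thesis
    using prob_space.prob_space_distr[OF M meas] prob_space.prob_space[OF M]
    by (intro exI[of _ ?D]) auto
qed

section \<open>Finite-dimensional laws of the path measure, and ergodicity\<close>

lemma measurable_path_law_component:
  assumes "stochastic_matrix p"
  shows "(\<lambda>\<omega>. \<omega> n) \<in> path_law p i \<rightarrow>\<^sub>M count_space UNIV"
  unfolding measurable_cong_sets[OF sets_path_law[OF assms] refl]
  by (rule measurable_component_singleton) simp

lemma sets_path_law_component:
  assumes "stochastic_matrix p"
  shows "{\<omega>. \<omega> n \<in> A} \<in> sets (path_law p i)"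
  using measurable_sets[OF measurable_path_law_component[OF assms], of A]
  by (simp add: space_path_law[OF assms] vimage_def)

text \<open>The event is a finite disjoint union of cylinders: members of \<open>A\<close> are
  extensional on \<open>{..n}\<close>, so each is determined by its values up to time
  \<open>n\<close>.\<close>

lemma measure_path_law_finite_dim:
  assumes p: "stochastic_matrix p" and A: "A \<subseteq> PiE {..n} (\<lambda>_. UNIV)"
  shows "measure (path_law p i) {\<omega>. restrict \<omega> {..n} \<in> A} =
    (\<Sum>x\<in>A. indicator {i} (x 0) * (\<Prod>k<n. p (x k) (x (Suc k))))"
proof -
  interpret prob_space "path_law p i" by (rule prob_space_path_law[OF p])
  let ?C = "\<lambda>x. {\<omega>. \<forall>k\<le>n. \<omega> k = x k}"
  have fin: "finite A"
    using A by (rule finite_subset) (intro finite_PiE; simp)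
  have "{\<omega>. restrict \<omega> {..n} \<in> A} = (\<Union>x\<in>A. ?C x)"
  proof (intro set_eqI iffI)
    fix \<omega> assume "\<omega> \<in> {\<omega>. restrict \<omega> {..n} \<in> A}"
    then show "\<omega> \<in> (\<Union>x\<in>A. ?C x)"
      by (intro UN_I[of "restrict \<omega> {..n}"]) simp_all
  next
    fix \<omega> assume "\<omega> \<in> (\<Union>x\<in>A. ?C x)"
    then obtain x where x: "x \<in> A" "\<forall>k\<le>n. \<omega> k = x k" by blast
    then have "restrict \<omega> {..n} = x"
      using A by (intro PiE_ext[of _ "{..n}" "\<lambda>_. UNIV"]) auto
    with x show "\<omega> \<in> {\<omega>. restrict \<omega> {..n} \<in> A}" by simp
  qed
  also have "prob \<dots> = (\<Sum>x\<in>A. prob (?C x))"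
  proof (rule finite_measure_finite_Union[OF fin])
    show "?C ` A \<subseteq> events"
      using sets_cylinder[OF p, of "Suc n"] by (auto simp: less_Suc_eq_le)
    show "disjoint_family_on ?C A"
      unfolding disjoint_family_on_def
    proof (intro ballI impI)
      fix x y assume xy: "x \<in> A" "y \<in> A" "x \<noteq> y"
      then have "\<exists>k\<le>n. x k \<noteq> y k"
        using A PiE_ext[of x "{..n}" "\<lambda>_. UNIV" y] by auto
      then show "?C x \<inter> ?C y = {}" by auto
    qed
  qed
  finally show ?thesis
    using path_law_cylinder[OF p] by (simp add: space_path_law[OF p])
qed

text \<open>The Markov property without conditioning, hence valid for null histories: extending a
  history that ends in \<open>k\<close> by \<open>j\<close> multiplies its path weight by
  \<open>p k j\<close>.\<close>

lemma measure_path_law_step: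
  assumes p: "stochastic_matrix p"
  shows "measure (path_law p i) {\<omega>. restrict \<omega> {..n} \<in> A \<and> \<omega> n = k \<and> \<omega> (Suc n) = j} =
    measure (path_law p i) {\<omega>. restrict \<omega> {..n} \<in> A \<and> \<omega> n = k} * p k j"
proof -
  \<comment> \<open>Only extensional members of \<open>A\<close> can equal a restricted path;
    dropping the others makes \<open>?e\<close> injective.\<close>
  define A' where "A' = {x \<in> A \<inter> PiE {..n} (\<lambda>_. UNIV). x n = k}"
  let ?e = "\<lambda>x :: nat \<Rightarrow> 'a. x(Suc n := j)"
  have A': "A' \<subseteq> PiE {..n} (\<lambda>_. UNIV)" "?e ` A' \<subseteq> PiE {..Suc n} (\<lambda>_. UNIV)"
    by (auto simp: A'_def atMost_Suc intro!: PiE_fun_upd)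
  have inj: "inj_on ?e A'"
  proof (rule inj_onI)
    fix x y assume "x \<in> A'" "y \<in> A'" and eq: "?e x = ?e y"
    then have "x \<in> extensional {..n}" "y \<in> extensional {..n}" by (auto simp: A'_def PiE_iff)
    then show "x = y"
      using eq by (intro extensionalityI[of _ "{..n}"]) (auto dest!: fun_cong split: if_splits)
  qed
  have restr: "restrict \<omega> {..Suc n} \<in> ?e ` A' \<longleftrightarrow> restrict \<omega> {..n} \<in> A' \<and> \<omega> (Suc n) = j" for \<omega>
  proof
    assume "restrict \<omega> {..Suc n} \<in> ?e ` A'"
    then obtain x where x: "x \<in> A'" and eq: "restrict \<omega> {..Suc n} = ?e x" by blast
    have "restrict \<omega> {..n} = x"
    proof (rule extensionalityI[of _ "{..n}"])
      show "x \<in> extensional {..n}" using x A' by (auto simp: PiE_iff)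
      show "restrict \<omega> {..n} m = x m" if "m \<in> {..n}" for m
        using fun_cong[OF eq, of m] that by simp
    qed simp
    moreover have "\<omega> (Suc n) = j" using fun_cong[OF eq, of "Suc n"] by simp
    ultimately show "restrict \<omega> {..n} \<in> A' \<and> \<omega> (Suc n) = j" using x by simp
  next
    assume *: "restrict \<omega> {..n} \<in> A' \<and> \<omega> (Suc n) = j"
    have "restrict \<omega> {..Suc n} = ?e (restrict \<omega> {..n})"
      using * by (intro ext) (simp add: le_Suc_eq)
    with * show "restrict \<omega> {..Suc n} \<in> ?e ` A'" by blast
  qed
  have "measure (path_law p i) {\<omega>. restrict \<omega> {..n} \<in> A \<and> \<omega> n = k \<and> \<omega> (Suc n) = j} =
      measure (path_law p i) {\<omega>. restrict \<omega> {..Suc n} \<in> ?e ` A'}"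
    unfolding restr by (intro arg_cong[where f="measure _"] Collect_cong) (auto simp: A'_def)
  also have "\<dots> = (\<Sum>x\<in>A'. indicator {i} (?e x 0) * (\<Prod>m<Suc n. p (?e x m) (?e x (Suc m))))"
    unfolding measure_path_law_finite_dim[OF p A'(2)] by (rule sum.reindex_cong[OF inj refl]) simp
  also have "\<dots> = (\<Sum>x\<in>A'. indicator {i} (x 0) * (\<Prod>m<n. p (x m) (x (Suc m)))) * p k j"
    unfolding sum_distrib_right
  proof (rule sum.cong[OF refl])
    fix x assume "x \<in> A'"
    then have "x n = k" by (simp add: A'_def)
    moreover have "(\<Prod>m<n. p (?e x m) (?e x (Suc m))) = (\<Prod>m<n. p (x m) (x (Suc m)))"
      by (rule prod.cong) auto
    ultimately show "indicator {i} (?e x 0) * (\<Prod>m<Suc n. p (?e x m) (?e x (Suc m))) =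
        indicator {i} (x 0) * (\<Prod>m<n. p (x m) (x (Suc m))) * p k j"
      by simp
  qed
  also have "(\<Sum>x\<in>A'. indicator {i} (x 0) * (\<Prod>m<n. p (x m) (x (Suc m)))) =
      measure (path_law p i) {\<omega>. restrict \<omega> {..n} \<in> A'}"
    using measure_path_law_finite_dim[OF p A'(1)] by simp
  also have "{\<omega>. restrict \<omega> {..n} \<in> A'} = {\<omega>. restrict \<omega> {..n} \<in> A \<and> \<omega> n = k}"
    by (auto simp: A'_def)
  finally show ?thesis .
qed

text \<open>A forbidden transition at a fixed time is null by \<open>measure_path_law_step\<close>,
  and there are only countably many choices of time and states.\<close>

lemma AE_path_law_transition_pos:
  assumes p: "stochastic_matrix p"
  shows "AE \<omega> in path_law p i. \<forall>n. p (\<omega> n) (\<omega> (Suc n)) \<noteq> 0"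
proof -
  interpret prob_space "path_law p i" by (rule prob_space_path_law[OF p])
  have null: "AE \<omega> in path_law p i. \<not> (\<omega> n = k \<and> \<omega> (Suc n) = j)" if "p k j = 0" for n k j
  proof (rule AE_I)
    have "{\<omega>. \<omega> n = k \<and> \<omega> (Suc n) = j} = {\<omega>. \<omega> n \<in> {k}} \<inter> {\<omega>. \<omega> (Suc n) \<in> {j}}"
      by auto
    then show *: "{\<omega>. \<omega> n = k \<and> \<omega> (Suc n) = j} \<in> events"
      by (simp only:) (intro sets.Int sets_path_law_component[OF p])
    show "emeasure (path_law p i) {\<omega>. \<omega> n = k \<and> \<omega> (Suc n) = j} = 0"
      using measure_path_law_step[OF p, of i n UNIV k j] that by (simp add: emeasure_eq_measure)
  qed auto
  have "AE \<omega> in path_law p i. p k j = 0 \<longrightarrow> \<not> (\<omega> n = k \<and> \<omega> (Suc n) = j)" for n k j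
    using null by (cases "p k j = 0") simp_all
  then have "AE \<omega> in path_law p i. \<forall>n k j. p k j = 0 \<longrightarrow> \<not> (\<omega> n = k \<and> \<omega> (Suc n) = j)"
    unfolding AE_all_countable by blast
  then show ?thesis by eventually_elim auto
qed

text \<open>The form in which ergodicity enters below: a path started in \<open>A\<close> almost
  surely makes only transitions with \<open>p i j \<noteq> 0\<close>, so it stays in
  \<open>A\<close> and never hits a state outside.\<close>

lemma ergodic_chain_closed_set:
  assumes p: "stochastic_matrix p" and erg: "ergodic_chain p" and A: "A \<noteq> {}"
    and closed: "\<And>i j. i \<in> A \<Longrightarrow> p i j \<noteq> 0 \<Longrightarrow> j \<in> A"
  shows "A = UNIV"
proof (rule ccontr)
  assume "A \<noteq> UNIV"
  then obtain i j where i: "i \<in> A" and j: "j \<notin> A" using A by blast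
  interpret prob_space "path_law p i" by (rule prob_space_path_law[OF p])
  have "AE \<omega> in path_law p i. \<not> (\<exists>n. \<omega> n = j)"
    using path_law_start[OF p, of i] AE_path_law_transition_pos[OF p, of i]
  proof eventually_elim
    case (elim \<omega>)
    have "\<omega> n \<in> A" for n
      by (induction n) (use elim i closed in auto)
    then show ?case using j by blast
  qed
  moreover have "{\<omega> \<in> space (path_law p i). \<exists>n. \<omega> n = j} \<in> events"
  proof -
    have "{\<omega> \<in> space (path_law p i). \<exists>n. \<omega> n = j} = (\<Union>n. {\<omega>. \<omega> n \<in> {j}})"
      by (auto simp: space_path_law[OF p])
    then show ?thesis
      by (simp only:) (intro sets.countable_UN image_subsetI sets_path_law_component[OF p])
  qed
  ultimately have "\<P>(\<omega> in path_law p i. \<exists>n. \<omega> n = j) = 0"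
    by (simp only: prob_Collect_eq_0)
  moreover have "0 < \<P>(\<omega> in path_law p i. \<exists>n. \<omega> n = j)"
    using i j by (intro erg[unfolded ergodic_chain_def, rule_format]) auto
  ultimately show False by simp
qed

section \<open>Return times and taboo probabilities\<close>

lemma return_time_greater_iff:
  "return_time W \<omega> > enat n \<longleftrightarrow> (\<forall>k\<in>{1..n}. \<omega> k \<notin> W)"
proof -
  let ?M = "{k. 0 < k \<and> \<omega> k \<in> W}"
  \<comment> \<open>A nonstrict lower bound passes through the infimum, even over the empty
    set.\<close>
  have "enat n < return_time W \<omega> \<longleftrightarrow> enat (Suc n) \<le> return_time W \<omega>"
    by (metis Suc_ile_eq)
  also have "\<dots> \<longleftrightarrow> (\<forall>k\<in>?M. Suc n \<le> k)"
    unfolding return_time_def by (simp add: le_INF_iff)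
  also have "\<dots> \<longleftrightarrow> (\<forall>k\<in>{1..n}. \<omega> k \<notin> W)"
    by (auto simp: not_less_eq_eq[symmetric] Suc_le_eq)
  finally show ?thesis .
qed

lemma measure_path_law_partition:
  fixes p :: "'s::finite \<Rightarrow> 's \<Rightarrow> real"
  assumes p: "stochastic_matrix p" and E: "E \<in> sets (path_law p i)"
  shows "measure (path_law p i) E = (\<Sum>k\<in>UNIV. measure (path_law p i) {\<omega>\<in>E. \<omega> n = k})"
proof -
  interpret prob_space "path_law p i" by (rule prob_space_path_law[OF p])
  have "{\<omega>\<in>E. \<omega> n = k} \<in> events" for k
  proof -
    have "{\<omega>\<in>E. \<omega> n = k} = E \<inter> {\<omega>. \<omega> n \<in> {k}}" by auto
    then show ?thesis
      by (simp only:) (intro sets.Int E sets_path_law_component[OF p])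
  qed
  then have "prob (\<Union>k\<in>UNIV. {\<omega>\<in>E. \<omega> n = k}) = (\<Sum>k\<in>UNIV. prob {\<omega>\<in>E. \<omega> n = k})"
    by (intro finite_measure_finite_Union) (auto simp: disjoint_family_on_def)
  also have "(\<Union>k\<in>UNIV. {\<omega>\<in>E. \<omega> n = k}) = E" by auto
  finally show ?thesis .
qed

text \<open>Time \<open>0\<close> is exempt so that the chain may start in \<open>W\<close>; for
  \<open>n > 0\<close> all the mass sits outside \<open>W\<close>.\<close>

definition taboo_prob :: "('s::finite \<Rightarrow> 's \<Rightarrow> real) \<Rightarrow> 's set \<Rightarrow> 's \<Rightarrow> nat \<Rightarrow> 's \<Rightarrow> real" where
  "taboo_prob p W i n j = measure (path_law p i) {\<omega>. (\<forall>k\<in>{1..n}. \<omega> k \<notin> W) \<and> \<omega> n = j}"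

lemma sets_path_law_avoid:
  assumes p: "stochastic_matrix p"
  shows "{\<omega>. \<forall>k\<in>{1..n}. \<omega> k \<notin> W} \<in> sets (path_law p i)"
proof -
  note [measurable] = measurable_path_law_component[OF p]
  have "{\<omega>\<in>space (path_law p i). \<forall>k\<in>{1..n}. \<omega> k \<notin> W} \<in> sets (path_law p i)"
    by measurable
  then show ?thesis by (simp add: space_path_law[OF p])
qed

lemma taboo_prob_0:
  assumes p: "stochastic_matrix p"
  shows "taboo_prob p W i 0 j = of_bool (j = i)"
  using path_law_cylinder[OF p, of i 0 "\<lambda>_. j"]
  by (simp add: taboo_prob_def space_path_law[OF p] indicator_def)

text \<open>Forward recursion: decompose over the state at time \<open>n\<close> and apply the
  unconditioned Markov property.\<close>

lemma taboo_prob_Suc: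
  assumes p: "stochastic_matrix p"
  shows "taboo_prob p W i (Suc n) j =
    (if j \<in> W then 0 else \<Sum>k\<in>UNIV. taboo_prob p W i n k * p k j)"
proof (cases "j \<in> W")
  case True
  then have "{\<omega>. (\<forall>k\<in>{1..Suc n}. \<omega> k \<notin> W) \<and> \<omega> (Suc n) = j} = {}" by auto
  then show ?thesis using True by (simp only: taboo_prob_def measure_empty if_True)
next
  case False
  let ?A = "{x. \<forall>k\<in>{1..n}. x k \<notin> W}"
  let ?E = "{\<omega>. (\<forall>k\<in>{1..Suc n}. \<omega> k \<notin> W) \<and> \<omega> (Suc n) = j}"
  have "?E = {\<omega>. \<forall>k\<in>{1..Suc n}. \<omega> k \<notin> W} \<inter> {\<omega>. \<omega> (Suc n) \<in> {j}}" by auto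
  also have "\<dots> \<in> sets (path_law p i)"
    by (intro sets.Int sets_path_law_avoid sets_path_law_component p)
  finally have "taboo_prob p W i (Suc n) j = (\<Sum>k\<in>UNIV. measure (path_law p i) {\<omega>\<in>?E. \<omega> n = k})"
    unfolding taboo_prob_def by (rule measure_path_law_partition[OF p])
  moreover have "measure (path_law p i) {\<omega>\<in>?E. \<omega> n = k} = taboo_prob p W i n k * p k j" for k
  proof -
    have "{\<omega>\<in>?E. \<omega> n = k} = {\<omega>. restrict \<omega> {..n} \<in> ?A \<and> \<omega> n = k \<and> \<omega> (Suc n) = j}"
      using False by (auto simp: le_Suc_eq)
    then show ?thesis
      using measure_path_law_step[OF p, of i n ?A k j] by (simp add: taboo_prob_def)
  qed
  ultimately show ?thesis using False by simp
qed

lemma prob_return_time_greater: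
  assumes p: "stochastic_matrix p"
  shows "\<P>(\<omega> in path_law p i. return_time W \<omega> > enat n) = (\<Sum>j\<in>UNIV. taboo_prob p W i n j)"
  unfolding taboo_prob_def return_time_greater_iff
  using measure_path_law_partition[OF p sets_path_law_avoid[OF p, of n W i], of n]
  by (simp add: space_path_law[OF p])

text \<open>Return times are integers or infinite, so the strict event below \<open>Suc n\<close> is
  the complement of exceeding \<open>n\<close>; hence the shift between \<open>s + 2\<close> and
  \<open>s + 1\<close>.\<close>

lemma prob_return_time_less:
  assumes p: "stochastic_matrix p"
  shows "\<P>(\<omega> in path_law p i. return_time W \<omega> < enat (Suc n)) =
    1 - \<P>(\<omega> in path_law p i. return_time W \<omega> > enat n)"
proof -
  interpret prob_space "path_law p i" by (rule prob_space_path_law[OF p])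
  have "return_time W \<omega> < enat (Suc n) \<longleftrightarrow> \<not> return_time W \<omega> > enat n" for \<omega>
    by (metis Suc_ile_eq not_le)
  moreover have "{\<omega> \<in> space (path_law p i). return_time W \<omega> > enat n} \<in> events"
    using sets_path_law_avoid[OF p, of n W i]
    by (simp only: return_time_greater_iff space_path_law[OF p] UNIV_I simp_thms)
  ultimately show ?thesis by (simp only: prob_neg)
qed

section \<open>The killed chain and its spectrum\<close>

locale reversible_off =
  fixes p :: "'s::finite \<Rightarrow> 's \<Rightarrow> real" and \<pi> :: "'s \<Rightarrow> real" and W :: "'s set"
  assumes stochastic: "stochastic_matrix p"
    and ergodic: "ergodic_chain p"
    and invariant: "invariant_distribution p \<pi>"
    and W_nonempty: "W \<noteq> {}" and W_proper: "W \<noteq> UNIV"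
    and reversible: "\<And>i j. i \<notin> W \<Longrightarrow> j \<notin> W \<Longrightarrow> \<pi> i * p i j = \<pi> j * p j i"
begin

lemma p_nonneg: "0 \<le> p i j" and p_row_sum: "(\<Sum>j\<in>UNIV. p i j) = 1"
  using stochastic by (auto simp: stochastic_matrix_def)

lemma invariant_sum: "(\<Sum>i\<in>UNIV. \<pi> i * p i j) = \<pi> j"
  using invariant by (simp add: invariant_distribution_def)

text \<open>Invariance gives \<open>\<pi> k * p k j \<le> \<pi> j\<close>, so the support of
  \<open>\<pi>\<close> is closed under transitions. Positivity permits the divisions by
  \<open>sqrt (\<pi> j)\<close> below.\<close>

lemma invariant_pos: "0 < \<pi> i"
proof -
  have nn: "0 \<le> \<pi> k" for k
    using invariant by (simp add: invariant_distribution_def)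
  have s: "(\<Sum>k\<in>UNIV. \<pi> k) = 1"
    using invariant by (simp add: invariant_distribution_def)
  have "{k. \<pi> k \<noteq> 0} = UNIV"
  proof (rule ergodic_chain_closed_set[OF stochastic ergodic])
    show "{k. \<pi> k \<noteq> 0} \<noteq> {}" using s by force
    fix k j assume k: "k \<in> {k. \<pi> k \<noteq> 0}" and kj: "p k j \<noteq> 0"
    have "0 < \<pi> k * p k j"
      using k kj nn[of k] p_nonneg[of k j] by (simp add: less_le)
    also have "\<dots> \<le> (\<Sum>i\<in>UNIV. \<pi> i * p i j)"
      by (rule member_le_sum) (use nn p_nonneg in auto)
    finally show "j \<in> {k. \<pi> k \<noteq> 0}" by (simp add: invariant_sum)
  qed
  then show ?thesis using nn[of i] by (auto simp: less_le)
qed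

text \<open>Detailed balance divided by \<open>sqrt (\<pi> j) * sqrt (\<pi> k)\<close>.\<close>

lemma sqrt_reversible:
  assumes "j \<notin> W" "k \<notin> W"
  shows "sqrt (\<pi> k) * p k j / sqrt (\<pi> j) = sqrt (\<pi> j) * p j k / sqrt (\<pi> k)"
proof -
  have "sqrt (\<pi> k) * (sqrt (\<pi> k) * p k j) = sqrt (\<pi> j) * (sqrt (\<pi> j) * p j k)"
    using reversible[OF assms(2,1)] invariant_pos by (simp add: less_imp_le flip: mult.assoc)
  then show ?thesis
    using invariant_pos[of j] invariant_pos[of k] by (simp add: field_simps)
qed

text \<open>
  Conjugating by \<open>sqrt \<pi>\<close> turns self-adjointness in \<open>L\<^sup>2(\<pi>)\<close> into symmetry of a real matrix; the rows
  and columns in \<open>W\<close> are padded with zeros, which only adds the eigenvalue \<open>0\<close>.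
\<close>

definition killed_matrix :: "real^'s^'s" where
  "killed_matrix = (\<chi> j k. if j \<in> W \<or> k \<in> W then 0 else sqrt (\<pi> k) * p k j / sqrt (\<pi> j))"

text \<open>The image of the constant function \<open>1\<close> off \<open>W\<close> under the
  conjugation, extended by zero on \<open>W\<close>.\<close>

definition sqrt_density :: "real^'s" where
  "sqrt_density = (\<chi> j. if j \<in> W then 0 else sqrt (\<pi> j))"

lemma killed_matrix_symmetric: "(killed_matrix *v x) \<bullet> y = x \<bullet> (killed_matrix *v y)"
proof -
  have "transpose killed_matrix = killed_matrix"
    by (auto simp: transpose_def killed_matrix_def vec_eq_iff sqrt_reversible)
  then show ?thesis
    by (metis dot_lmul_matrix transpose_matrix_vector)
qed

lemma killed_matrix_eigenvalue:
  assumes v: "v \<noteq> 0" and ev: "killed_matrix *v v = l *\<^sub>R v"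
  shows "\<bar>l\<bar> < 1"
proof (rule ccontr)
  assume "\<not> \<bar>l\<bar> < 1"
  then have l: "1 \<le> \<bar>l\<bar>" by simp
  have vW: "v $ j = 0" if "j \<in> W" for j
  proof -
    have "l * v $ j = (killed_matrix *v v) $ j" using ev by simp
    also have "\<dots> = 0" using that by (simp add: matrix_vector_mult_def killed_matrix_def)
    finally show ?thesis using l by auto
  qed
  \<comment> \<open>Dividing by \<open>sqrt (\<pi> j)\<close> undoes the conjugation; the absolute
    value treats \<open>l \<ge> 1\<close> and \<open>l \<le> -1\<close> at once.\<close>
  define f where "f j = \<bar>v $ j\<bar> / sqrt (\<pi> j)" for j
  define M where "M = Max (range f)"
  have fM: "f j \<le> M" for j by (simp add: M_def)
  obtain j0 where "v $ j0 \<noteq> 0" using v by (auto simp: vec_eq_iff)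
  then have "0 < f j0" using invariant_pos[of j0] by (simp add: f_def)
  then have M: "0 < M" using fM[of j0] by simp
  \<comment> \<open>Off \<open>W\<close>, \<open>sqrt_reversible\<close> turns the eigenvalue
    equation into one for row \<open>j\<close> of \<open>p\<close>. As \<open>v\<close> vanishes on
    \<open>W\<close>, the sum may run over the whole row.\<close>
  have sub: "\<bar>l\<bar> * f j \<le> (\<Sum>k\<in>UNIV. p j k * f k)" for j
  proof (cases "j \<in> W")
    case True
    then show ?thesis using p_nonneg invariant_pos by (simp add: f_def vW sum_nonneg less_imp_le)
  next
    case False
    have "l * v $ j = (killed_matrix *v v) $ j" using ev by simp
    also have "\<dots> = (\<Sum>k\<in>UNIV. sqrt (\<pi> j) * (p j k * (v $ k / sqrt (\<pi> k))))"
      unfolding matrix_vector_mult_def vec_lambda_beta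
    proof (intro sum.cong refl)
      fix k
      show "killed_matrix $ j $ k * v $ k = sqrt (\<pi> j) * (p j k * (v $ k / sqrt (\<pi> k)))"
        using sqrt_reversible[of j k] False by (cases "k \<in> W") (simp_all add: killed_matrix_def vW)
    qed
    finally have "l * v $ j = sqrt (\<pi> j) * (\<Sum>k\<in>UNIV. p j k * (v $ k / sqrt (\<pi> k)))"
      by (simp only: sum_distrib_left)
    then have eq: "l * (v $ j / sqrt (\<pi> j)) = (\<Sum>k\<in>UNIV. p j k * (v $ k / sqrt (\<pi> k)))"
      using invariant_pos[of j] by simp
    have "\<bar>l\<bar> * f j = \<bar>l * (v $ j / sqrt (\<pi> j))\<bar>"
      using invariant_pos[of j] by (simp add: f_def abs_mult less_imp_le)
    also have "\<dots> = \<bar>\<Sum>k\<in>UNIV. p j k * (v $ k / sqrt (\<pi> k))\<bar>"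
      by (simp only: eq)
    also have "\<dots> \<le> (\<Sum>k\<in>UNIV. \<bar>p j k * (v $ k / sqrt (\<pi> k))\<bar>)"
      by (rule sum_abs)
    also have "\<dots> = (\<Sum>k\<in>UNIV. p j k * f k)"
      using p_nonneg invariant_pos by (simp add: f_def abs_mult less_imp_le)
    finally show ?thesis .
  qed
  have "{j. f j = M} = UNIV"
  proof (rule ergodic_chain_closed_set[OF stochastic ergodic])
    have "M \<in> range f" unfolding M_def by (rule Max_in) auto
    then show "{j. f j = M} \<noteq> {}" by auto
    fix j k assume j: "j \<in> {j. f j = M}" and jk: "p j k \<noteq> 0"
    \<comment> \<open>Row \<open>j\<close> averages the nonnegative gaps \<open>M - f k\<close> to
      at most \<open>0\<close>, so every gap with \<open>p j k \<noteq> 0\<close> is zero.\<close>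
    have "(\<Sum>k\<in>UNIV. p j k * (M - f k)) = M - (\<Sum>k\<in>UNIV. p j k * f k)"
      using p_row_sum[of j] by (simp add: right_diff_distrib sum_subtractf flip: sum_distrib_right)
    also have "\<dots> \<le> M - \<bar>l\<bar> * M" using sub[of j] j by simp
    also have "\<dots> \<le> 0" using l M by simp
    finally have "(\<Sum>k\<in>UNIV. p j k * (M - f k)) \<le> 0" .
    moreover have nn: "0 \<le> p j k * (M - f k)" for k using p_nonneg fM by simp
    ultimately have "(\<Sum>k\<in>UNIV. p j k * (M - f k)) = 0"
      by (intro antisym sum_nonneg) auto
    then have "p j k * (M - f k) = 0"
      using nn by (simp add: sum_nonneg_eq_0_iff)
    then show "k \<in> {j. f j = M}" using jk by simp
  qed
  then have "f i = M" for i by blast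
  moreover obtain i where "i \<in> W" using W_nonempty by blast
  then have "f i = 0" by (simp add: f_def vW)
  ultimately show False using M by simp
qed

section \<open>Spectral form of the return-time tail\<close>

definition return_tail :: "nat \<Rightarrow> real" where
  "return_tail s = (\<Sum>i\<in>W. \<P>(\<omega> in path_law p i. return_time W \<omega> > enat (s + 1)) * \<pi> i)"

text \<open>The first step out of \<open>W\<close> is the balance of \<open>\<pi>\<close> at
  \<open>j\<close>; each later step moves mass forward by \<open>p\<close> off \<open>W\<close>,
  which is \<open>killed_matrix\<close> after removing the factor
  \<open>sqrt (\<pi> j)\<close>.\<close>

lemma taboo_prob_killed_matrix:
  "(\<Sum>i\<in>W. \<pi> i * taboo_prob p W i (Suc s) j) =
    sqrt_density $ j * (((*v) killed_matrix ^^ s) (sqrt_density - killed_matrix *v sqrt_density)) $ j"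
proof (induction s arbitrary: j)
  case 0
  show ?case
  proof (cases "j \<in> W")
    case False
    have "taboo_prob p W i (Suc 0) j = p i j" for i
      using False by (simp add: taboo_prob_Suc[OF stochastic] taboo_prob_0[OF stochastic] of_bool_def
          if_distrib[of "\<lambda>x. x * _"] cong: if_cong)
    moreover have "sqrt (\<pi> j) * (killed_matrix *v sqrt_density) $ j = (\<Sum>k\<in>- W. \<pi> k * p k j)"
    proof -
      have "sqrt (\<pi> j) * (killed_matrix *v sqrt_density) $ j =
          (\<Sum>k\<in>UNIV. if k \<in> - W then \<pi> k * p k j else 0)"
        unfolding matrix_vector_mult_def vec_lambda_beta sum_distrib_left
        using False invariant_pos by (intro sum.cong refl)
          (auto simp: killed_matrix_def sqrt_density_def less_imp_le less_imp_neq[symmetric])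
      then show ?thesis by (simp add: sum.If_cases Compl_eq)
    qed
    \<comment> \<open>Invariance splits \<open>\<pi> j\<close> into inflow from \<open>W\<close> and
      from its complement; the latter was just identified with the matrix term.\<close>
    moreover have "(\<Sum>k\<in>W. \<pi> k * p k j) + (\<Sum>k\<in>- W. \<pi> k * p k j) = \<pi> j"
      using sum.subset_diff[of W UNIV "\<lambda>k. \<pi> k * p k j"] invariant_sum[of j]
      by (simp add: Compl_eq_Diff_UNIV add.commute)
    ultimately show ?thesis
      using False invariant_pos[of j] by (simp add: sqrt_density_def right_diff_distrib)
  qed (simp add: taboo_prob_Suc[OF stochastic] sqrt_density_def)
next
  case (Suc s)
  define y where "y = ((*v) killed_matrix ^^ s) (sqrt_density - killed_matrix *v sqrt_density)"
  show ?case
  proof (cases "j \<in> W")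
    case False
    have "(\<Sum>i\<in>W. \<pi> i * taboo_prob p W i (Suc (Suc s)) j) =
        (\<Sum>i\<in>W. \<Sum>k\<in>UNIV. \<pi> i * taboo_prob p W i (Suc s) k * p k j)"
      using False by (subst taboo_prob_Suc[OF stochastic]) (simp add: sum_distrib_left mult.assoc)
    also have "\<dots> = (\<Sum>k\<in>UNIV. (\<Sum>i\<in>W. \<pi> i * taboo_prob p W i (Suc s) k) * p k j)"
      by (subst sum.swap) (simp add: sum_distrib_right)
    also have "\<dots> = (\<Sum>k\<in>UNIV. sqrt_density $ k * y $ k * p k j)"
      unfolding Suc.IH y_def ..
    \<comment> \<open>For \<open>k \<in> W\<close> both summands are zero, by
      \<open>sqrt_density\<close> on the left and by the padding on the right.\<close>
    also have "\<dots> = (\<Sum>k\<in>UNIV. sqrt_density $ j * (killed_matrix $ j $ k * y $ k))"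
      using False invariant_pos[of j]
      by (intro sum.cong refl) (simp add: sqrt_density_def killed_matrix_def)
    also have "\<dots> = sqrt_density $ j * (killed_matrix *v y) $ j"
      by (simp add: matrix_vector_mult_def sum_distrib_left)
    finally show ?thesis by (simp add: y_def)
  qed (simp add: taboo_prob_Suc[OF stochastic] sqrt_density_def)
qed

text \<open>Summing over the final state turns the factor \<open>sqrt_density $ j\<close> into an
  inner product; linearity of the matrix power splits it into two consecutive moments.\<close>

lemma return_tail_killed_matrix:
  "return_tail s = sqrt_density \<bullet> ((*v) killed_matrix ^^ s) sqrt_density
    - sqrt_density \<bullet> ((*v) killed_matrix ^^ Suc s) sqrt_density"
proof -
  have "return_tail s = (\<Sum>j\<in>UNIV. \<Sum>i\<in>W. \<pi> i * taboo_prob p W i (Suc s) j)"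
    unfolding return_tail_def prob_return_time_greater[OF stochastic]
    by (subst sum.swap) (simp add: sum_distrib_left sum_distrib_right mult.commute)
  also have "\<dots> = sqrt_density \<bullet> ((*v) killed_matrix ^^ s) (sqrt_density - killed_matrix *v sqrt_density)"
    unfolding taboo_prob_killed_matrix by (simp add: inner_vec_def)
  also have "((*v) killed_matrix ^^ s) (x - y) =
      ((*v) killed_matrix ^^ s) x - ((*v) killed_matrix ^^ s) y" for x y
    by (induction s) (simp_all add: matrix_vector_mult_diff_distrib)
  finally show ?thesis by (simp add: inner_diff_right funpow_swap1)
qed

text \<open>\<open>W\<close> is nonempty and proper, hence not closed: some transition leaves
  \<open>W\<close>, and taking it first gives a return time above \<open>1\<close>.\<close>

lemma return_tail_0_pos: "0 < return_tail 0"
proof -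
  obtain i j where ij: "i \<in> W" "j \<notin> W" "p i j \<noteq> 0"
    using ergodic_chain_closed_set[OF stochastic ergodic W_nonempty] W_proper by blast
  have taboo_nn: "0 \<le> taboo_prob p W k n m" for k n m by (simp add: taboo_prob_def)
  have "taboo_prob p W i (Suc 0) j = p i j"
    using ij by (simp add: taboo_prob_Suc[OF stochastic] taboo_prob_0[OF stochastic] of_bool_def
        if_distrib[of "\<lambda>x. x * _"] cong: if_cong)
  then have "0 < taboo_prob p W i (Suc 0) j"
    using ij p_nonneg[of i j] by simp
  also have "\<dots> \<le> (\<Sum>m\<in>UNIV. taboo_prob p W i (Suc 0) m)"
    by (rule member_le_sum) (use taboo_nn in auto)
  also have "\<dots> = \<P>(\<omega> in path_law p i. return_time W \<omega> > enat 1)"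
    by (simp add: prob_return_time_greater[OF stochastic])
  finally have "0 < \<P>(\<omega> in path_law p i. return_time W \<omega> > enat 1) * \<pi> i"
    using invariant_pos by simp
  also have "\<dots> \<le> (\<Sum>k\<in>W. \<P>(\<omega> in path_law p k. return_time W \<omega> > enat 1) * \<pi> k)"
    by (rule member_le_sum) (use ij invariant_pos in \<open>auto simp: less_imp_le\<close>)
  finally show ?thesis by (simp add: return_tail_def)
qed

lemma return_cdf_return_tail: "1 - return_cdf p \<pi> W (s + 2) = return_tail s / (\<Sum>i\<in>W. \<pi> i)"
proof -
  have "0 < (\<Sum>i\<in>W. \<pi> i)"
    using W_nonempty invariant_pos by (intro sum_pos) auto
  moreover have "return_cdf p \<pi> W (Suc (Suc s)) = ((\<Sum>i\<in>W. \<pi> i) - return_tail s) / (\<Sum>i\<in>W. \<pi> i)"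
    unfolding return_cdf_def return_tail_def prob_return_time_less[OF stochastic]
    by (simp add: sum_subtractf left_diff_distrib flip: sum_divide_distrib)
  ultimately show ?thesis by (simp add: field_simps)
qed

text \<open>The difference of consecutive moments multiplies each spectral weight by
  \<open>1 - l b\<close>, which is positive since \<open>\<bar>l b\<bar> < 1\<close>; the mixture
  stays nonnegative.\<close>

lemma return_tail_mixture:
  "\<exists>\<mu> :: real measure. prob_space \<mu> \<and> sets \<mu> = sets borel \<and> measure \<mu> {-1<..<1} = 1 \<and>
    (\<forall>s. return_tail s / return_tail 0 = (\<integral>l. semichar l s \<partial>\<mu>))"
proof -
  obtain B l w where B: "finite B" and ev: "\<And>b. b \<in> B \<Longrightarrow> b \<noteq> 0 \<and> killed_matrix *v b = l b *\<^sub>R b"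
    and w: "\<And>b. b \<in> B \<Longrightarrow> 0 \<le> w b"
    and moments: "\<And>s. sqrt_density \<bullet> ((*v) killed_matrix ^^ s) sqrt_density = (\<Sum>b\<in>B. w b * l b ^ s)"
    using selfadjoint_moments[OF matrix_vector_mul_linear killed_matrix_symmetric] by blast
  have l: "\<bar>l b\<bar> < 1" if "b \<in> B" for b
    using killed_matrix_eigenvalue ev[OF that] by blast
  define v where "v b = w b * (1 - l b) / return_tail 0" for b
  have tail: "return_tail s / return_tail 0 = (\<Sum>b\<in>B. v b * l b ^ s)" for s
    unfolding return_tail_killed_matrix[of s] moments v_def
    by (simp add: sum_subtractf[symmetric] sum_divide_distrib algebra_simps)
  have "0 \<le> v b" if "b \<in> B" for b
    using w[OF that] l[OF that] return_tail_0_pos by (simp add: v_def)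
  \<comment> \<open>Total mass is the case \<open>s = 0\<close>, where \<open>0 ^ 0 = 1\<close> also
    counts the weights at eigenvalue \<open>0\<close>.\<close>
  moreover have "(\<Sum>b\<in>B. v b) = 1"
    using tail[of 0] return_tail_0_pos by simp
  moreover have "l b \<in> {-1<..<1}" if "b \<in> B" for b
    using l[OF that] by auto
  ultimately obtain \<mu> :: "real measure" where "prob_space \<mu>" "sets \<mu> = sets borel"
    "measure \<mu> {-1<..<1} = 1" "\<And>s. (\<integral>x. x ^ s \<partial>\<mu>) = (\<Sum>b\<in>B. v b * l b ^ s)"
    using finite_mixture_measure[OF B, of v l "{-1<..<1}"] by auto
  then show ?thesis
    by (intro exI[of _ \<mu>]) (simp add: tail semichar_def)
qed

end

theorem theorem3:
  fixes p :: "'s::finite \<Rightarrow> 's \<Rightarrow> real" and \<pi> :: "'s \<Rightarrow> real" and W :: "'s set"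
  assumes "stochastic_matrix p"
    and "ergodic_chain p"
    and "invariant_distribution p \<pi>"
    and "W \<noteq> {}" and "W \<subset> UNIV"
    and "\<And>i j. i \<in> UNIV - W \<Longrightarrow> j \<in> UNIV - W \<Longrightarrow> \<pi> i * p i j = \<pi> j * p j i"
  shows "\<exists>\<mu> :: real measure. prob_space \<mu> \<and> sets \<mu> = sets borel \<and> measure \<mu> {-1<..<1} = 1 \<and>
    (\<forall>s :: nat.
       (1 - return_cdf p \<pi> W (s + 2)) / (1 - return_cdf p \<pi> W 2) =
         (\<Sum>i\<in>W. \<P>(\<omega> in path_law p i. return_time W \<omega> > enat (s + 1)) * \<pi> i) /
         (\<Sum>i\<in>W. \<P>(\<omega> in path_law p i. return_time W \<omega> > enat 1) * \<pi> i) \<and>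
       (\<Sum>i\<in>W. \<P>(\<omega> in path_law p i. return_time W \<omega> > enat (s + 1)) * \<pi> i) /
         (\<Sum>i\<in>W. \<P>(\<omega> in path_law p i. return_time W \<omega> > enat 1) * \<pi> i) =
         (\<integral>l. semichar l s \<partial>\<mu>))"
proof -
  interpret reversible_off p \<pi> W
    by unfold_locales (use assms in auto)
  have tail_0: "(\<Sum>i\<in>W. \<P>(\<omega> in path_law p i. return_time W \<omega> > enat 1) * \<pi> i) = return_tail 0"
    by (simp add: return_tail_def)
  \<comment> \<open>The normalising mass of \<open>W\<close> divides both tails and cancels in the
    quotient.\<close>
  have "(\<Sum>i\<in>W. \<pi> i) \<noteq> 0"
    using sum_pos[of W \<pi>] invariant_pos W_nonempty by force
  then have "(1 - return_cdf p \<pi> W (s + 2)) / (1 - return_cdf p \<pi> W 2) = return_tail s / return_tail 0" for s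
    using return_cdf_return_tail[of s] return_cdf_return_tail[of 0, unfolded add_0] by simp
  then show ?thesis
    using return_tail_mixture unfolding tail_0 return_tail_def[symmetric] by simp
qed

end
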